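(* Let $R$ be a commutative ring with unity, let $S$ be a proper multiplicatively closed subset of $R$, let $\phi:R\to S^{-1}R$ be the map $\phi(r)=\frac{r}{1}$, and suppose that $S^{-1}R$ is a $\phi(S)$-field. Then $R$ is an $S$-field if any one of the following holds: (1) $S$ is a finite set. (2) $R$ is an $S$-PID.
   Context: A multiplicatively closed subset $S$ of a commutative ring $R$ is a subset with $1\in S$, $0\notin S$, and $st\in S$ for all $s,t\in S$. It is called proper if it contains neither zero nor zero divisors of $R$. Here $\phi(S)=\left\{\frac{s}{1}\mid s\in S\right\}$, a multiplicatively closed subset of $S^{-1}R$. For a commutative ring $A$ with multiplicatively closed subset $T$: an ideal $I$ of $A$ with $I\cap T=\emptyset$ is $T$-maximal if there exists $t\in T$ such that for every ideal $J$ of $A$ with $I\subseteq J$, either $tJ\subseteq I$ or $J\cap T\neq\emptyset$; and $A$ is a $T$-field if its zero ideal is a $T$-maximal ideal of $A$. The ring $R$ is an $S$-integral domain if there exists $s\in S$ such that for all $a,b\in R$ with $ab=0$, either $sa=0$ or $sb=0$. The ring $R$ is an $S$-PID if it is an $S$-integral domain and every ideal $I$ of $R$ is $S$-principal, i.e. there exist $s\in S$ and $a\in I$ such that $sI\subseteq \langle a\rangle\subseteq I$. *)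

theory Defs
  imports "HOL-Algebra.Ideal" "HOL-Algebra.Coset"
begin

definition mult_closed_subset :: "('a, 'b) ring_scheme \<Rightarrow> 'a set \<Rightarrow> bool" where
  "mult_closed_subset R S \<longleftrightarrow>
     S \<subseteq> carrier R \<and> \<one>\<^bsub>R\<^esub> \<in> S \<and> \<zero>\<^bsub>R\<^esub> \<notin> S \<and> (\<forall>s\<in>S. \<forall>t\<in>S. s \<otimes>\<^bsub>R\<^esub> t \<in> S)"

definition zero_divisor :: "('a, 'b) ring_scheme \<Rightarrow> 'a \<Rightarrow> bool" where
  "zero_divisor R a \<longleftrightarrow>
     a \<in> carrier R \<and> (\<exists>b\<in>carrier R. b \<noteq> \<zero>\<^bsub>R\<^esub> \<and> a \<otimes>\<^bsub>R\<^esub> b = \<zero>\<^bsub>R\<^esub>)"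

definition proper_mult_closed_subset :: "('a, 'b) ring_scheme \<Rightarrow> 'a set \<Rightarrow> bool" where
  "proper_mult_closed_subset R S \<longleftrightarrow>
     mult_closed_subset R S \<and> \<zero>\<^bsub>R\<^esub> \<notin> S \<and> (\<forall>s\<in>S. \<not> zero_divisor R s)"

text \<open>The ring of fractions \<open>S\<^sup>-\<^sup>1R\<close> is the quotient of \<open>R \<times> S\<close> by the relation
  \<open>(r, s) \<sim> (r', s')\<close> iff \<open>u (r s' - r' s) = 0\<close> for some \<open>u \<in> S\<close>.  The operations take the
  union over all representatives, which is a single class because they respect the relation
  (see \<open>loc_add_fraction\<close> and \<open>loc_mult_fraction\<close>).\<close>

definition loc_rel :: "('a, 'b) ring_scheme \<Rightarrow> 'a set \<Rightarrow> (('a \<times> 'a) \<times> ('a \<times> 'a)) set" where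
  "loc_rel R S = {((r, s), (r', s')). r \<in> carrier R \<and> s \<in> S \<and> r' \<in> carrier R \<and> s' \<in> S \<and>
     (\<exists>u\<in>S. u \<otimes>\<^bsub>R\<^esub> (r \<otimes>\<^bsub>R\<^esub> s' \<ominus>\<^bsub>R\<^esub> r' \<otimes>\<^bsub>R\<^esub> s) = \<zero>\<^bsub>R\<^esub>)}"

definition fraction :: "('a, 'b) ring_scheme \<Rightarrow> 'a set \<Rightarrow> 'a \<Rightarrow> 'a \<Rightarrow> ('a \<times> 'a) set" where
  "fraction R S r s = loc_rel R S `` {(r, s)}"

definition localization :: "('a, 'b) ring_scheme \<Rightarrow> 'a set \<Rightarrow> ('a \<times> 'a) set ring" where
  "localization R S =
    \<lparr>carrier = (carrier R \<times> S) // loc_rel R S,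
     mult = (\<lambda>X Y. \<Union>(r, s)\<in>X. \<Union>(r', s')\<in>Y. fraction R S (r \<otimes>\<^bsub>R\<^esub> r') (s \<otimes>\<^bsub>R\<^esub> s')),
     one = fraction R S \<one>\<^bsub>R\<^esub> \<one>\<^bsub>R\<^esub>,
     zero = fraction R S \<zero>\<^bsub>R\<^esub> \<one>\<^bsub>R\<^esub>,
     add = (\<lambda>X Y. \<Union>(r, s)\<in>X. \<Union>(r', s')\<in>Y.
              fraction R S (r \<otimes>\<^bsub>R\<^esub> s' \<oplus>\<^bsub>R\<^esub> r' \<otimes>\<^bsub>R\<^esub> s) (s \<otimes>\<^bsub>R\<^esub> s'))\<rparr>"

definition loc_map :: "('a, 'b) ring_scheme \<Rightarrow> 'a set \<Rightarrow> 'a \<Rightarrow> ('a \<times> 'a) set" where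
  "loc_map R S r = fraction R S r \<one>\<^bsub>R\<^esub>"

text \<open>In the following notions \<open>R\<close> is meant to be a commutative ring with multiplicatively closed
  subset \<open>S\<close>.  The set \<open>s I = {s x | x \<in> I}\<close> is written as the coset \<open>s <#\<^bsub>R\<^esub> I\<close> of the
  multiplicative monoid.\<close>

definition S_maximal :: "('a, 'b) ring_scheme \<Rightarrow> 'a set \<Rightarrow> 'a set \<Rightarrow> bool" where
  "S_maximal R S I \<longleftrightarrow> ideal I R \<and> I \<inter> S = {} \<and>
     (\<exists>s\<in>S. \<forall>J. ideal J R \<longrightarrow> I \<subseteq> J \<longrightarrow> s <#\<^bsub>R\<^esub> J \<subseteq> I \<or> J \<inter> S \<noteq> {})"

definition S_field :: "('a, 'b) ring_scheme \<Rightarrow> 'a set \<Rightarrow> bool" where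
  "S_field R S \<longleftrightarrow> S_maximal R S {\<zero>\<^bsub>R\<^esub>}"

definition S_integral_domain :: "('a, 'b) ring_scheme \<Rightarrow> 'a set \<Rightarrow> bool" where
  "S_integral_domain R S \<longleftrightarrow>
     (\<exists>s\<in>S. \<forall>a\<in>carrier R. \<forall>b\<in>carrier R. a \<otimes>\<^bsub>R\<^esub> b = \<zero>\<^bsub>R\<^esub> \<longrightarrow>
        s \<otimes>\<^bsub>R\<^esub> a = \<zero>\<^bsub>R\<^esub> \<or> s \<otimes>\<^bsub>R\<^esub> b = \<zero>\<^bsub>R\<^esub>)"

definition S_principal :: "('a, 'b) ring_scheme \<Rightarrow> 'a set \<Rightarrow> 'a set \<Rightarrow> bool" where
  "S_principal R S I \<longleftrightarrow>
     (\<exists>s\<in>S. \<exists>a\<in>I. s <#\<^bsub>R\<^esub> I \<subseteq> PIdl\<^bsub>R\<^esub> a \<and> PIdl\<^bsub>R\<^esub> a \<subseteq> I)"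

definition S_PID :: "('a, 'b) ring_scheme \<Rightarrow> 'a set \<Rightarrow> bool" where
  "S_PID R S \<longleftrightarrow> S_integral_domain R S \<and> (\<forall>I. ideal I R \<longrightarrow> S_principal R S I)"

context
  fixes R (structure) and S
  assumes R: "cring R" and S: "mult_closed_subset R S"
begin

interpretation cring R by (rule R)

lemma S_carr: "s \<in> S \<Longrightarrow> s \<in> carrier R"
  using S by (auto simp: mult_closed_subset_def)

lemma S_mult: "s \<in> S \<Longrightarrow> t \<in> S \<Longrightarrow> s \<otimes> t \<in> S"
  using S by (auto simp: mult_closed_subset_def)

lemma S_one: "\<one> \<in> S"
  using S by (auto simp: mult_closed_subset_def)

lemma loc_rel_iff:
  "((r, s), (r', s')) \<in> loc_rel R S \<longleftrightarrow>
     r \<in> carrier R \<and> s \<in> S \<and> r' \<in> carrier R \<and> s' \<in> S \<and> (\<exists>u\<in>S. u \<otimes> (r \<otimes> s') = u \<otimes> (r' \<otimes> s))"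
proof -
  have "u \<otimes> (r \<otimes> s' \<ominus> r' \<otimes> s) = \<zero> \<longleftrightarrow> u \<otimes> (r \<otimes> s') = u \<otimes> (r' \<otimes> s)"
    if "r \<in> carrier R" "s \<in> S" "r' \<in> carrier R" "s' \<in> S" "u \<in> S" for u
  proof -
    have "u \<otimes> (r \<otimes> s' \<ominus> r' \<otimes> s) = u \<otimes> (r \<otimes> s') \<ominus> u \<otimes> (r' \<otimes> s)"
      using that by (simp add: S_carr a_minus_def r_distr r_minus)
    then show ?thesis
      using that minus_equality[of "u \<otimes> (r \<otimes> s')" "\<ominus> (u \<otimes> (r' \<otimes> s))"]
      by (auto simp: S_carr a_minus_def r_neg)
  qed
  then show ?thesis by (auto simp: loc_rel_def)
qed

lemma equiv_loc_rel: "equiv (carrier R \<times> S) (loc_rel R S)"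
proof (rule equivI)
  show "loc_rel R S \<subseteq> (carrier R \<times> S) \<times> (carrier R \<times> S)"
    by (auto simp: loc_rel_def)
  show "refl_on (carrier R \<times> S) (loc_rel R S)"
    using S_one by (auto simp: refl_on_def loc_rel_iff)
  show "sym (loc_rel R S)"
    by (rule symI, clarify) (unfold loc_rel_iff, metis)
  show "trans (loc_rel R S)"
  proof (rule transI, clarify)
    fix a s b t c w
    assume "((a, s), (b, t)) \<in> loc_rel R S" "((b, t), (c, w)) \<in> loc_rel R S"
    then obtain u v where *: "a \<in> carrier R" "s \<in> S" "b \<in> carrier R" "t \<in> S" "c \<in> carrier R" "w \<in> S"
      "u \<in> S" "v \<in> S" "u \<otimes> (a \<otimes> t) = u \<otimes> (b \<otimes> s)" "v \<otimes> (b \<otimes> w) = v \<otimes> (c \<otimes> t)"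
      by (auto simp: loc_rel_iff)
    have "(u \<otimes> v \<otimes> t) \<otimes> (a \<otimes> w) = (u \<otimes> (a \<otimes> t)) \<otimes> (v \<otimes> w)"
      using *(1-8) by (simp add: S_carr m_ac)
    also have "\<dots> = (v \<otimes> (b \<otimes> w)) \<otimes> (u \<otimes> s)"
      unfolding *(9) using *(1-8) by (simp add: S_carr m_ac)
    also have "\<dots> = (u \<otimes> v \<otimes> t) \<otimes> (c \<otimes> s)"
      unfolding *(10) using *(1-8) by (simp add: S_carr m_ac)
    finally show "((a, s), (c, w)) \<in> loc_rel R S"
      using * by (auto simp: loc_rel_iff intro!: bexI[of _ "u \<otimes> v \<otimes> t"] S_mult)
  qed
qed

lemma fraction_eqI:
  assumes "a \<in> carrier R" "s \<in> S" "b \<in> carrier R" "t \<in> S" "u \<in> S"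
    and "u \<otimes> (a \<otimes> t) = u \<otimes> (b \<otimes> s)"
  shows "fraction R S a s = fraction R S b t"
  unfolding fraction_def
  by (rule equiv_class_eq[OF equiv_loc_rel]) (use assms in \<open>auto simp: loc_rel_iff\<close>)

lemma fraction_eqI':
  assumes "a \<in> carrier R" "s \<in> S" "b \<in> carrier R" "t \<in> S" "a \<otimes> t = b \<otimes> s"
  shows "fraction R S a s = fraction R S b t"
  using assms fraction_eqI[of a s b t \<one>] S_one by simp

lemma loc_mult_fraction:
  assumes "a \<in> carrier R" "s \<in> S" "b \<in> carrier R" "t \<in> S"
  shows "fraction R S a s \<otimes>\<^bsub>localization R S\<^esub> fraction R S b t = fraction R S (a \<otimes> b) (s \<otimes> t)"
proof -
  let ?f = "\<lambda>(r, s) (r', s'). fraction R S (r \<otimes> r') (s \<otimes> s')"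
  have "congruent2 (loc_rel R S) (loc_rel R S) ?f"
  proof (rule congruent2I', clarify)
    fix a s a' s' b t b' t'
    assume "((a, s), (a', s')) \<in> loc_rel R S" "((b, t), (b', t')) \<in> loc_rel R S"
    then obtain u v where *: "a \<in> carrier R" "s \<in> S" "a' \<in> carrier R" "s' \<in> S"
      "b \<in> carrier R" "t \<in> S" "b' \<in> carrier R" "t' \<in> S" "u \<in> S" "v \<in> S"
      "u \<otimes> (a \<otimes> s') = u \<otimes> (a' \<otimes> s)" "v \<otimes> (b \<otimes> t') = v \<otimes> (b' \<otimes> t)"
      by (auto simp: loc_rel_iff)
    have "(u \<otimes> v) \<otimes> (a \<otimes> b \<otimes> (s' \<otimes> t')) = (u \<otimes> (a \<otimes> s')) \<otimes> (v \<otimes> (b \<otimes> t'))"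
      using *(1-10) by (simp add: S_carr m_ac)
    also have "\<dots> = (u \<otimes> v) \<otimes> (a' \<otimes> b' \<otimes> (s \<otimes> t))"
      unfolding *(11,12) using *(1-10) by (simp add: S_carr m_ac)
    finally show "fraction R S (a \<otimes> b) (s \<otimes> t) = fraction R S (a' \<otimes> b') (s' \<otimes> t')"
      using *(1-10) by (intro fraction_eqI[of _ _ _ _ "u \<otimes> v"]) (auto intro: S_mult)
  qed
  from UN_equiv_class2[OF equiv_loc_rel equiv_loc_rel this, of "(a, s)" "(b, t)"] assms
  show ?thesis by (simp add: localization_def fraction_def split_def)
qed

lemma loc_add_fraction:
  assumes "a \<in> carrier R" "s \<in> S" "b \<in> carrier R" "t \<in> S"
  shows "fraction R S a s \<oplus>\<^bsub>localization R S\<^esub> fraction R S b t =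
         fraction R S (a \<otimes> t \<oplus> b \<otimes> s) (s \<otimes> t)"
proof -
  let ?f = "\<lambda>(r, s) (r', s'). fraction R S (r \<otimes> s' \<oplus> r' \<otimes> s) (s \<otimes> s')"
  have "congruent2 (loc_rel R S) (loc_rel R S) ?f"
  proof (rule congruent2I', clarify)
    fix a s a' s' b t b' t'
    assume "((a, s), (a', s')) \<in> loc_rel R S" "((b, t), (b', t')) \<in> loc_rel R S"
    then obtain u v where *: "a \<in> carrier R" "s \<in> S" "a' \<in> carrier R" "s' \<in> S"
      "b \<in> carrier R" "t \<in> S" "b' \<in> carrier R" "t' \<in> S" "u \<in> S" "v \<in> S"
      "u \<otimes> (a \<otimes> s') = u \<otimes> (a' \<otimes> s)" "v \<otimes> (b \<otimes> t') = v \<otimes> (b' \<otimes> t)"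
      by (auto simp: loc_rel_iff)
    have "(u \<otimes> v) \<otimes> ((a \<otimes> t \<oplus> b \<otimes> s) \<otimes> (s' \<otimes> t')) =
        (u \<otimes> (a \<otimes> s')) \<otimes> (v \<otimes> t \<otimes> t') \<oplus> (v \<otimes> (b \<otimes> t')) \<otimes> (u \<otimes> s \<otimes> s')"
      using *(1-10) by (simp add: S_carr m_ac l_distr r_distr)
    also have "\<dots> = (u \<otimes> v) \<otimes> ((a' \<otimes> t' \<oplus> b' \<otimes> s') \<otimes> (s \<otimes> t))"
      unfolding *(11,12) using *(1-10) by (simp add: S_carr m_ac l_distr r_distr)
    finally show "fraction R S (a \<otimes> t \<oplus> b \<otimes> s) (s \<otimes> t) =
        fraction R S (a' \<otimes> t' \<oplus> b' \<otimes> s') (s' \<otimes> t')"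
      using *(1-10) by (intro fraction_eqI[of _ _ _ _ "u \<otimes> v"]) (auto intro: S_mult S_carr)
  qed
  from UN_equiv_class2[OF equiv_loc_rel equiv_loc_rel this, of "(a, s)" "(b, t)"] assms
  show ?thesis by (simp add: localization_def fraction_def split_def)
qed

lemma fraction_closed:
  "a \<in> carrier R \<Longrightarrow> s \<in> S \<Longrightarrow> fraction R S a s \<in> carrier (localization R S)"
  by (auto simp: localization_def fraction_def intro!: quotientI)

lemma loc_carrierE:
  assumes "x \<in> carrier (localization R S)"
  obtains a s where "a \<in> carrier R" "s \<in> S" "x = fraction R S a s"
  using assms by (auto simp: localization_def fraction_def elim!: quotientE)

lemma loc_one: "\<one>\<^bsub>localization R S\<^esub> = fraction R S \<one> \<one>"
  and loc_zero: "\<zero>\<^bsub>localization R S\<^esub> = fraction R S \<zero> \<one>"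
  by (simp_all add: localization_def)

theorem cring_localization: "cring (localization R S)"
proof (rule cringI)
  note simps = loc_one loc_zero loc_mult_fraction loc_add_fraction S_carr S_mult S_one
    fraction_closed
  show "abelian_group (localization R S)"
  proof (rule abelian_groupI)
    fix x assume "x \<in> carrier (localization R S)"
    then obtain a s where x: "a \<in> carrier R" "s \<in> S" "x = fraction R S a s"
      by (rule loc_carrierE)
    have "fraction R S (\<ominus> a) s \<oplus>\<^bsub>localization R S\<^esub> x = \<zero>\<^bsub>localization R S\<^esub>"
      using x by (simp add: simps l_minus l_neg) (rule fraction_eqI'; simp add: simps)
    then show "\<exists>y\<in>carrier (localization R S). y \<oplus>\<^bsub>localization R S\<^esub> x = \<zero>\<^bsub>localization R S\<^esub>"
      using x by (auto intro: fraction_closed)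
  qed (auto elim!: loc_carrierE simp: simps l_distr r_distr m_ac a_ac)
  show "comm_monoid (localization R S)"
    by (rule comm_monoidI) (auto elim!: loc_carrierE simp: simps m_ac)
  show "(x \<oplus>\<^bsub>localization R S\<^esub> y) \<otimes>\<^bsub>localization R S\<^esub> z =
      x \<otimes>\<^bsub>localization R S\<^esub> z \<oplus>\<^bsub>localization R S\<^esub> y \<otimes>\<^bsub>localization R S\<^esub> z"
    if "x \<in> carrier (localization R S)" "y \<in> carrier (localization R S)"
      "z \<in> carrier (localization R S)" for x y z
  proof -
    from that obtain a s b t c w where *: "a \<in> carrier R" "s \<in> S" "b \<in> carrier R" "t \<in> S"
      "c \<in> carrier R" "w \<in> S" "x = fraction R S a s" "y = fraction R S b t" "z = fraction R S c w"
      by (metis loc_carrierE)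
    have "fraction R S ((a \<otimes> t \<oplus> b \<otimes> s) \<otimes> c) (s \<otimes> t \<otimes> w) =
        fraction R S (a \<otimes> c \<otimes> (t \<otimes> w) \<oplus> b \<otimes> c \<otimes> (s \<otimes> w)) (s \<otimes> w \<otimes> (t \<otimes> w))"
      by (rule fraction_eqI') (use *(1-6) in \<open>simp_all add: S_carr S_mult l_distr r_distr m_ac\<close>)
    then show ?thesis
      using * by (simp add: loc_mult_fraction loc_add_fraction S_carr S_mult)
  qed
qed

lemma loc_map_ring_hom: "loc_map R S \<in> ring_hom R (localization R S)"
  by (rule ring_hom_memI)
     (simp_all add: loc_map_def loc_one loc_mult_fraction loc_add_fraction S_one fraction_closed)

end

lemma mult_closed_subset_loc_map:
  assumes "cring R" "proper_mult_closed_subset R S"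
  shows "mult_closed_subset (localization R S) (loc_map R S ` S)"
proof -
  interpret cring R by fact
  have S: "mult_closed_subset R S"
    using assms by (auto simp: proper_mult_closed_subset_def)
  note carr = S_carr[OF assms(1) S] and one = S_one[OF assms(1) S] and mult = S_mult[OF assms(1) S]
  note hom = loc_map_ring_hom[OF assms(1) S]
  have "fraction R S \<zero>\<^bsub>R\<^esub> \<one>\<^bsub>R\<^esub> \<noteq> loc_map R S s" if "s \<in> S" for s
  proof
    assume "fraction R S \<zero>\<^bsub>R\<^esub> \<one>\<^bsub>R\<^esub> = loc_map R S s"
    then have "((\<zero>\<^bsub>R\<^esub>, \<one>\<^bsub>R\<^esub>), (s, \<one>\<^bsub>R\<^esub>)) \<in> loc_rel R S"
      using eq_equiv_class[OF _ equiv_loc_rel[OF assms(1) S]] that one carr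
      by (fastforce simp: fraction_def loc_map_def)
    then obtain u where "u \<in> S" "u \<otimes>\<^bsub>R\<^esub> s = \<zero>\<^bsub>R\<^esub>"
      by (auto simp: loc_rel_iff[OF assms(1) S] carr that)
    then show False
      using that mult S by (metis mult_closed_subset_def)
  qed
  then have "\<zero>\<^bsub>localization R S\<^esub> \<notin> loc_map R S ` S"
    by (auto simp: localization_def)
  moreover have "\<one>\<^bsub>localization R S\<^esub> \<in> loc_map R S ` S"
    using ring_hom_one[OF hom] one by force
  moreover have "loc_map R S s \<otimes>\<^bsub>localization R S\<^esub> loc_map R S t \<in> loc_map R S ` S"
    if "s \<in> S" "t \<in> S" for s t
    using that ring_hom_mult[OF hom carr carr, symmetric] mult by simp
  ultimately show ?thesis
    using ring_hom_closed[OF hom carr] unfolding mult_closed_subset_def by blast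
qed

end

theory Submission
  imports Defs
begin

text \<open>Elements of \<open>\<phi>(S)\<close> are units of \<open>S\<^sup>-\<^sup>1R\<close>, so an ideal of \<open>S\<^sup>-\<^sup>1R\<close> that meets \<open>\<phi>(S)\<close> is
  the whole ring, and a \<open>\<phi>(S)\<close>-field \<open>S\<^sup>-\<^sup>1R\<close> is an honest field.  Divisibility in this field
  descends to \<open>R\<close>: if a multiple \<open>(b/t)(a/1)\<close> equals \<open>s/1\<close>, clearing denominators
  puts a multiple of \<open>a\<close> into \<open>S\<close> (\<open>multiple_in_S_if_principal_meets\<close>).  So an ideal \<open>J\<close> of
  \<open>R\<close> that misses \<open>S\<close> contains only elements \<open>a\<close> for which \<open>\<langle>a/1\<rangle>\<close> misses \<open>\<phi>(S)\<close>; for these the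
  hypothesis gives \<open>sa/1 = 0\<close>, where \<open>s\<close> is fixed by the choice of \<open>\<phi>(s)\<close> as witness that
  \<open>S\<^sup>-\<^sup>1R\<close> is a \<open>\<phi>(S)\<close>-field.  Since \<open>S\<close> contains no zero divisors, \<open>\<phi>\<close> is injective
  (\<open>loc_map_eq_zero_iff\<close>), hence \<open>sa = 0\<close> in \<open>R\<close>, and the same \<open>s\<close> is a witness for \<open>R\<close>.\<close>

lemma fraction_eq_iff:
  fixes R (structure)
  assumes "cring R" "mult_closed_subset R S"
    and "a \<in> carrier R" "s \<in> S" "b \<in> carrier R" "t \<in> S"
  shows "fraction R S a s = fraction R S b t \<longleftrightarrow> (\<exists>u\<in>S. u \<otimes> (a \<otimes> t) = u \<otimes> (b \<otimes> s))"
proof -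
  have "fraction R S a s = fraction R S b t \<longleftrightarrow> ((a, s), (b, t)) \<in> loc_rel R S"
    unfolding fraction_def
    by (rule eq_equiv_class_iff[OF equiv_loc_rel[OF assms(1,2)]]) (use assms in auto)
  then show ?thesis
    using assms by (simp add: loc_rel_iff)
qed

lemma loc_map_eq_zero_iff:
  fixes R (structure)
  assumes "cring R" "proper_mult_closed_subset R S" "a \<in> carrier R"
  shows "loc_map R S a = \<zero>\<^bsub>localization R S\<^esub> \<longleftrightarrow> a = \<zero>"
proof -
  interpret cring R by fact
  have S: "mult_closed_subset R S"
    using assms(2) by (simp add: proper_mult_closed_subset_def)
  note carr = S_carr[OF assms(1) S] and one = S_one[OF assms(1) S]
  have "loc_map R S a = \<zero>\<^bsub>localization R S\<^esub> \<longleftrightarrow> (\<exists>u\<in>S. u \<otimes> a = \<zero>)"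
    using assms(3) one
    by (simp add: loc_map_def loc_zero[OF assms(1) S] fraction_eq_iff[OF assms(1) S] carr)
  also have "\<dots> \<longleftrightarrow> a = \<zero>"
  proof
    assume "\<exists>u\<in>S. u \<otimes> a = \<zero>"
    then show "a = \<zero>"
      using assms(2,3) carr unfolding proper_mult_closed_subset_def zero_divisor_def by blast
  next
    assume "a = \<zero>"
    then show "\<exists>u\<in>S. u \<otimes> a = \<zero>"
      using one by force
  qed
  finally show ?thesis .
qed

text \<open>An equation \<open>(b/t)(a/1) = s/1\<close> means \<open>uba = uts\<close> for some \<open>u\<close> in \<open>S\<close>, and the right-hand side
  lies in \<open>S\<close>.\<close>

lemma multiple_in_S_if_principal_meets:
  fixes R (structure)
  assumes "cring R" "mult_closed_subset R S" "a \<in> carrier R"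
    and "PIdl\<^bsub>localization R S\<^esub> (loc_map R S a) \<inter> loc_map R S ` S \<noteq> {}"
  shows "\<exists>c\<in>carrier R. c \<otimes> a \<in> S"
proof -
  interpret cring R by fact
  note carr = S_carr[OF assms(1,2)] and one = S_one[OF assms(1,2)]
    and mult = S_mult[OF assms(1,2)]
  obtain x s where x: "x \<in> carrier (localization R S)" and s: "s \<in> S"
    and eq: "x \<otimes>\<^bsub>localization R S\<^esub> loc_map R S a = loc_map R S s"
    using assms(4) by (auto simp: cgenideal_def)
  obtain b t where b: "b \<in> carrier R" and t: "t \<in> S" and "x = fraction R S b t"
    using loc_carrierE[OF assms(1,2) x] by blast
  then have "fraction R S (b \<otimes> a) t = fraction R S s \<one>"
    using eq assms(3) one
    by (simp add: loc_map_def loc_mult_fraction[OF assms(1,2)] carr)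
  then obtain u where u: "u \<in> S" "u \<otimes> (b \<otimes> a) = u \<otimes> (s \<otimes> t)"
    using b t s assms(3) one carr
    by (auto simp: fraction_eq_iff[OF assms(1,2)])
  have "(u \<otimes> b) \<otimes> a = u \<otimes> (s \<otimes> t)"
    using u b assms(3) carr by (simp add: m_assoc)
  then have "(u \<otimes> b) \<otimes> a \<in> S"
    using u(1) s t mult by simp
  then show ?thesis
    using u(1) b carr by blast
qed

theorem theorem3p19:
  fixes R :: "('a, 'b) ring_scheme" and S :: "'a set"
  assumes "cring R"
    and "proper_mult_closed_subset R S"
    and "S_field (localization R S) (loc_map R S ` S)"
    and "finite S \<or> S_PID R S"
  shows "S_field R S"
proof -
  interpret cring R by fact
  have S: "mult_closed_subset R S"
    using assms(2) by (simp add: proper_mult_closed_subset_def)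
  let ?L = "localization R S" and ?\<phi> = "loc_map R S"
  interpret L: cring ?L by (rule cring_localization[OF assms(1) S])
  note hom = loc_map_ring_hom[OF assms(1) S] and carr = S_carr[OF assms(1) S]
  obtain s where s: "s \<in> S" and max: "\<forall>I. ideal I ?L \<longrightarrow> {\<zero>\<^bsub>?L\<^esub>} \<subseteq> I \<longrightarrow>
      ?\<phi> s <#\<^bsub>?L\<^esub> I \<subseteq> {\<zero>\<^bsub>?L\<^esub>} \<or> I \<inter> ?\<phi> ` S \<noteq> {}"
    using assms(3) unfolding S_field_def S_maximal_def by blast
  have "s <#\<^bsub>R\<^esub> J \<subseteq> {\<zero>\<^bsub>R\<^esub>}" if J: "ideal J R" and disj: "J \<inter> S = {}" for J
  proof -
    interpret J: ideal J R by (rule J)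
    have "s \<otimes>\<^bsub>R\<^esub> a = \<zero>\<^bsub>R\<^esub>" if a: "a \<in> J" for a
    proof -
      have aR: "a \<in> carrier R"
        using a by (rule J.Icarr)
      note \<phi>a = ring_hom_closed[OF hom aR]
      have "PIdl\<^bsub>?L\<^esub> (?\<phi> a) \<inter> ?\<phi> ` S = {}"
        using multiple_in_S_if_principal_meets[OF assms(1) S aR] J.I_l_closed[OF a] disj by blast
      moreover have "{\<zero>\<^bsub>?L\<^esub>} \<subseteq> PIdl\<^bsub>?L\<^esub> (?\<phi> a)"
        using additive_subgroup.zero_closed[OF ideal.axioms(1)[OF L.cgenideal_ideal[OF \<phi>a]]]
        by simp
      ultimately have "?\<phi> s <#\<^bsub>?L\<^esub> PIdl\<^bsub>?L\<^esub> (?\<phi> a) \<subseteq> {\<zero>\<^bsub>?L\<^esub>}"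
        using max[rule_format, OF L.cgenideal_ideal[OF \<phi>a]] by metis
      then have "?\<phi> s \<otimes>\<^bsub>?L\<^esub> ?\<phi> a = \<zero>\<^bsub>?L\<^esub>"
        using L.cgenideal_self[OF \<phi>a] unfolding l_coset_def by blast
      then have "?\<phi> (s \<otimes>\<^bsub>R\<^esub> a) = \<zero>\<^bsub>?L\<^esub>"
        using ring_hom_mult[OF hom carr[OF s] aR] by simp
      then show ?thesis
        using loc_map_eq_zero_iff[OF assms(1,2)] carr[OF s] aR by simp
    qed
    then show ?thesis
      by (auto simp: l_coset_def)
  qed
  moreover have "{\<zero>\<^bsub>R\<^esub>} \<inter> S = {}"
    using S by (auto simp: mult_closed_subset_def)
  ultimately show ?thesis
    unfolding S_field_def S_maximal_def
    using zeroideal by (intro conjI bexI[OF _ s] allI impI) auto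
qed

end
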